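(* Let $(\Lambda,d)$ be a source-free, row-finite $k$-graph, let $B\in\{\mathbf e_1,\dots,\mathbf e_k\}$, and let $(\Gamma,d_\Gamma)$ be the LiMaR-split of $\Lambda$ in degree $B$ (at a vertex $w$). If $k\ge 3$, additionally assume that $\Lambda$ is degree $B$ sink-free. Then $(\Gamma,d_\Gamma)$ is a source-free, row-finite $k$-graph.
   Context: Let $\mathbb N=\{0,1,2,\dots\}$, let $\mathbf e_1,\dots,\mathbf e_k$ be the standard basis of $\mathbb N^k$, and $|\mathbf n|=\sum_i n_i$. A $k$-graph ($k\ge 1$) is a countable small category $\Lambda$ with a functor $d:\Lambda\to\mathbb N^k$ such that whenever $d(\lambda)=\mathbf m+\mathbf n$ there are unique $\mu,\nu\in\Lambda$ with $\lambda=\mu\nu$, $d(\mu)=\mathbf m$, $d(\nu)=\mathbf n$. Write $\Lambda^{\mathbf n}=d^{-1}(\mathbf n)$, $\Lambda^0=d^{-1}(\mathbf 0)$ (vertices, identified with objects), $\Lambda^1=\{\lambda:|d(\lambda)|=1\}$ (edges); $r,s$ are range and source ($\lambda\mu$ is defined iff $s(\lambda)=r(\mu)$); $v\Lambda^{\mathbf n}=\{\lambda\in\Lambda^{\mathbf n}:r(\lambda)=v\}$. $\Lambda$ is row-finite if every $v\Lambda^{\mathbf e_i}$ is finite, and source-free if every $v\Lambda^{\mathbf e_i}$ is nonempty. $\Lambda$ is degree $\mathbf e_i$ sink-free if every vertex is the source of some edge of degree $\mathbf e_i$. The 1-skeleton $G$ of $\Lambda$ is the directed graph $(\Lambda^0,\Lambda^1,r,s)$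 with edges coloured by $d$; $G^*$ is its category of finite paths $f_m\cdots f_1$ with $s(f_{i+1})=r(f_i)$; for paths $\lambda,\mu\in G^*$, $\lambda\sim\mu$ means they have the same composite in $\Lambda$ (so $\Lambda=G^*/\!\sim$). LiMaR-split. Fix $B\in\{\mathbf e_1,\dots,\mathbf e_k\}$ and put $A=\{\mathbf e_1,\dots,\mathbf e_k\}\setminus\{B\}$. Write $s_B^{-1}(v)=\{e\in\Lambda^1:d(e)=B,\ s(e)=v\}$. Fix $w\in\Lambda^0$ with $|s_B^{-1}(w)|\ge2$. Let $S_w\subseteq\Lambda^0$ be the smallest set such that $w\in S_w$, and such that if $x\in S_w$ and $e\in\Lambda^1$ with $d(e)\in A$, $s(e)=x$, $|s_B^{-1}(r(e))|\ge2$, then $r(e)\in S_w$. Define $n:\Lambda^0\to\mathbb N$ by $n(v)=|s_B^{-1}(v)|$ if $v\in S_w$ and $n(v)=1$ otherwise (so it is assumed that $s_B^{-1}(v)$ is finite for $v\in S_w$). For each $v$ with $s_B^{-1}(v)\ne\emptyset$ fix a partition $s_B^{-1}(v)=\mathcal E^v_1\sqcup\dots\sqcup\mathcal E^v_{n(v)}$ into nonempty sets. The directed graph $G_L=(\Gamma^0,\Gamma^1,r_\Gamma,s_\Gamma)$ has $\Gamma^0=\{v^i:v\in\Lambda^0,1\le i\le n(v)\}$, $\Gamma^1=\{e^i:e\in\Lambda^1,1\le i\le n(r(e))\}$, $r_\Gamma(e^i)=r(e)^i$, and $s_\Gamma(e^i)=s(e)^j$ where: (1) if $d(e)=B$, $j$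 is the index with $e\in\mathcal E^{s(e)}_j$; (2) if $d(e)\in A$ and $s_B^{-1}(r(e))\neq\emptyset$, choose $f\in\mathcal E^{r(e)}_i$, let $ac$ be the path with $fe\sim ac$, $d(c)=B$, $d(a)=d(e)$, and $j$ is the index with $c\in\mathcal E_j^{s(c)}$ (this does not depend on the choice of $f$); (3) otherwise $j=1$. Let $par:G_L\to G$, $par(e^i)=e$, $par(v^i)=v$, extended to paths; $d_\Gamma(e^i)=d(e)$, extended additively to paths. For paths $\lambda,\mu\in G_L^*$ put $\lambda\sim_L\mu$ iff $par(\lambda)\sim par(\mu)$, $r_\Gamma(\lambda)=r_\Gamma(\mu)$ and $s_\Gamma(\lambda)=s_\Gamma(\mu)$. The LiMaR-split of $\Lambda$ in degree $B$ (at $w$) is $\Gamma=G_L^*/\!\sim_L$ with degree map $d_\Gamma$. *)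

theory Defs
  imports "HOL-Analysis.Finite_Cartesian_Product" "HOL-Library.Countable_Set"
    "HOL-Library.Disjoint_Sets" "Graph_Theory.Arc_Walk"
begin

section \<open>Higher-rank graphs\<close>

record ('v, 'm) category =
  Obj :: "'v set"
  Mor :: "'m set"
  Src :: "'m \<Rightarrow> 'v"
  Rng :: "'m \<Rightarrow> 'v"
  Ident :: "'v \<Rightarrow> 'm"
  Cmp :: "'m \<Rightarrow> 'm \<Rightarrow> 'm"

text \<open>\<^term>\<open>Cmp C l m\<close> is the product \<open>l m\<close>, defined when the source of \<open>l\<close> is the range
  of \<open>m\<close>. Nothing is required of the operations outside \<^const>\<open>Obj\<close> and \<^const>\<open>Mor\<close>.\<close>

locale small_category =
  fixes C :: "('v, 'm) category"
  assumes Src_in_Obj: "l \<in> Mor C \<Longrightarrow> Src C l \<in> Obj C"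
    and Rng_in_Obj: "l \<in> Mor C \<Longrightarrow> Rng C l \<in> Obj C"
    and Ident_in_Mor: "v \<in> Obj C \<Longrightarrow> Ident C v \<in> Mor C"
    and Src_Ident: "v \<in> Obj C \<Longrightarrow> Src C (Ident C v) = v"
    and Rng_Ident: "v \<in> Obj C \<Longrightarrow> Rng C (Ident C v) = v"
    and Cmp_in_Mor: "\<lbrakk>l \<in> Mor C; m \<in> Mor C; Src C l = Rng C m\<rbrakk> \<Longrightarrow> Cmp C l m \<in> Mor C"
    and Src_Cmp: "\<lbrakk>l \<in> Mor C; m \<in> Mor C; Src C l = Rng C m\<rbrakk> \<Longrightarrow> Src C (Cmp C l m) = Src C m"
    and Rng_Cmp: "\<lbrakk>l \<in> Mor C; m \<in> Mor C; Src C l = Rng C m\<rbrakk> \<Longrightarrow> Rng C (Cmp C l m) = Rng C l"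
    and Cmp_Ident_left: "l \<in> Mor C \<Longrightarrow> Cmp C (Ident C (Rng C l)) l = l"
    and Cmp_Ident_right: "l \<in> Mor C \<Longrightarrow> Cmp C l (Ident C (Src C l)) = l"
    and Cmp_assoc: "\<lbrakk>l \<in> Mor C; m \<in> Mor C; n \<in> Mor C; Src C l = Rng C m; Src C m = Rng C n\<rbrakk>
          \<Longrightarrow> Cmp C (Cmp C l m) n = Cmp C l (Cmp C m n)"

text \<open>The rank \<open>k\<close> is the cardinality of the index type \<open>'k\<close>. Countability of \<^const>\<open>Mor\<close>
  implies that of \<^const>\<open>Obj\<close>.\<close>

locale k_graph = small_category C
  for C :: "('v, 'm) category" +
  fixes d :: "'m \<Rightarrow> nat ^ 'k"
  assumes countable_Mor: "countable (Mor C)"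
    and degree_Ident: "v \<in> Obj C \<Longrightarrow> d (Ident C v) = 0"
    and degree_Cmp: "\<lbrakk>l \<in> Mor C; m \<in> Mor C; Src C l = Rng C m\<rbrakk> \<Longrightarrow> d (Cmp C l m) = d l + d m"
    and unique_factorization: "\<lbrakk>l \<in> Mor C; d l = a + b\<rbrakk> \<Longrightarrow>
          \<exists>!(p :: 'm \<times> 'm). fst p \<in> Mor C \<and> snd p \<in> Mor C \<and> Src C (fst p) = Rng C (snd p) \<and>
            l = Cmp C (fst p) (snd p) \<and> d (fst p) = a \<and> d (snd p) = b"

definition unit_degrees :: "(nat ^ 'k) set" where
  "unit_degrees = range (\<lambda>i. axis i 1)"

definition mors_into :: "('v, 'm) category \<Rightarrow> ('m \<Rightarrow> nat ^ 'k) \<Rightarrow> 'v \<Rightarrow> nat ^ 'k \<Rightarrow> 'm set" where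
  "mors_into C d v n = {l \<in> Mor C. d l = n \<and> Rng C l = v}"

definition row_finite :: "('v, 'm) category \<Rightarrow> ('m \<Rightarrow> nat ^ 'k) \<Rightarrow> bool" where
  "row_finite C d \<longleftrightarrow> (\<forall>v \<in> Obj C. \<forall>n \<in> unit_degrees. finite (mors_into C d v n))"

definition source_free :: "('v, 'm) category \<Rightarrow> ('m \<Rightarrow> nat ^ 'k) \<Rightarrow> bool" where
  "source_free C d \<longleftrightarrow> (\<forall>v \<in> Obj C. \<forall>n \<in> unit_degrees. mors_into C d v n \<noteq> {})"

definition edges :: "('v, 'm) category \<Rightarrow> ('m \<Rightarrow> nat ^ 'k) \<Rightarrow> 'm set" where
  "edges C d = {l \<in> Mor C. (\<Sum>i\<in>UNIV. d l $ i) = 1}"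

definition sink_free :: "('v, 'm) category \<Rightarrow> ('m \<Rightarrow> nat ^ 'k) \<Rightarrow> nat ^ 'k \<Rightarrow> bool" where
  "sink_free C d n \<longleftrightarrow> (\<forall>v \<in> Obj C. \<exists>e \<in> edges C d. d e = n \<and> Src C e = v)"

section \<open>Path categories and quotients\<close>

text \<open>A path is a triple of its source, its list of edges and its range. The edges are listed
  from source to range, as in \<^const>\<open>pre_digraph.awalk\<close>, so the path \<open>f\<^sub>m \<dots> f\<^sub>1\<close> has the edge
  list \<open>[f\<^sub>1, \<dots>, f\<^sub>m]\<close>. The empty list gives the path of length zero at a vertex.\<close>

type_synonym ('v, 'e) path = "'v \<times> 'e list \<times> 'v"

definition paths :: "('v, 'e) pre_digraph \<Rightarrow> ('v, 'e) path set" where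
  "paths G = {(u, p, v). pre_digraph.awalk G u p v}"

definition path_src :: "('v, 'e) path \<Rightarrow> 'v" where
  "path_src = (\<lambda>(u, p, v). u)"

definition path_rng :: "('v, 'e) path \<Rightarrow> 'v" where
  "path_rng = (\<lambda>(u, p, v). v)"

definition path_edges :: "('v, 'e) path \<Rightarrow> 'e list" where
  "path_edges = (\<lambda>(u, p, v). p)"

definition path_category :: "('v, 'e) pre_digraph \<Rightarrow> ('v, ('v, 'e) path) category" where
  "path_category G =
    \<lparr>Obj = verts G, Mor = paths G, Src = path_src, Rng = path_rng,
     Ident = (\<lambda>v. (v, [], v)),
     Cmp = (\<lambda>x y. (path_src y, path_edges y @ path_edges x, path_rng x))\<rparr>"

text \<open>Operations on classes are evaluated on all representatives; as usual they are only
  meaningful if the result does not depend on the representatives.\<close>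

definition quotient_category :: "('v, 'm) category \<Rightarrow> ('m \<times> 'm) set \<Rightarrow> ('v, 'm set) category" where
  "quotient_category C R =
    \<lparr>Obj = Obj C, Mor = Mor C // R,
     Src = (\<lambda>X. the_elem (Src C ` X)), Rng = (\<lambda>X. the_elem (Rng C ` X)),
     Ident = (\<lambda>v. R `` {Ident C v}),
     Cmp = (\<lambda>X Y. \<Union>x\<in>X. \<Union>y\<in>Y. R `` {Cmp C x y})\<rparr>"

definition skeleton :: "('v, 'm) category \<Rightarrow> ('m \<Rightarrow> nat ^ 'k) \<Rightarrow> ('v, 'm) pre_digraph" where
  "skeleton C d = \<lparr>verts = Obj C, arcs = edges C d, tail = Src C, head = Rng C\<rparr>"

definition composite :: "('v, 'm) category \<Rightarrow> ('v, 'm) path \<Rightarrow> 'm" where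
  "composite C x = foldl (\<lambda>l e. Cmp C e l) (Ident C (path_src x)) (path_edges x)"

definition path_equiv ::
    "('v, 'm) category \<Rightarrow> ('m \<Rightarrow> nat ^ 'k) \<Rightarrow> ('v, 'm) path \<Rightarrow> ('v, 'm) path \<Rightarrow> bool" where
  "path_equiv C d x y \<longleftrightarrow>
    x \<in> paths (skeleton C d) \<and> y \<in> paths (skeleton C d) \<and> composite C x = composite C y"

section \<open>The LiMaR-split\<close>

definition B_edges_from ::
    "('v, 'm) category \<Rightarrow> ('m \<Rightarrow> nat ^ 'k) \<Rightarrow> nat ^ 'k \<Rightarrow> 'v \<Rightarrow> 'm set" where
  "B_edges_from C d B v = {e \<in> edges C d. d e = B \<and> Src C e = v}"

text \<open>Since \<^const>\<open>card\<close> is zero on infinite sets, these are treated separately.\<close>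

definition at_least_two :: "'a set \<Rightarrow> bool" where
  "at_least_two X \<longleftrightarrow> infinite X \<or> 2 \<le> card X"

inductive_set split_verts ::
    "('v, 'm) category \<Rightarrow> ('m \<Rightarrow> nat ^ 'k) \<Rightarrow> nat ^ 'k \<Rightarrow> 'v \<Rightarrow> 'v set"
  for C d B w where
  base: "w \<in> split_verts C d B w"
| step: "\<lbrakk>x \<in> split_verts C d B w; e \<in> edges C d; d e \<in> unit_degrees - {B}; Src C e = x;
          at_least_two (B_edges_from C d B (Rng C e))\<rbrakk> \<Longrightarrow> Rng C e \<in> split_verts C d B w"

definition num_copies ::
    "('v, 'm) category \<Rightarrow> ('m \<Rightarrow> nat ^ 'k) \<Rightarrow> nat ^ 'k \<Rightarrow> 'v \<Rightarrow> 'v \<Rightarrow> nat" where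
  "num_copies C d B w v =
    (if v \<in> split_verts C d B w then card (B_edges_from C d B v) else 1)"

definition limar_partition ::
    "('v, 'm) category \<Rightarrow> ('m \<Rightarrow> nat ^ 'k) \<Rightarrow> nat ^ 'k \<Rightarrow> 'v \<Rightarrow> ('v \<Rightarrow> nat \<Rightarrow> 'm set) \<Rightarrow> bool" where
  "limar_partition C d B w E \<longleftrightarrow>
    (\<forall>v \<in> Obj C. B_edges_from C d B v \<noteq> {} \<longrightarrow>
      (\<Union>i \<in> {1..num_copies C d B w v}. E v i) = B_edges_from C d B v \<and>
      disjoint_family_on (E v) {1..num_copies C d B w v} \<and>
      (\<forall>i \<in> {1..num_copies C d B w v}. E v i \<noteq> {}))"

definition part_index ::
    "('v, 'm) category \<Rightarrow> ('m \<Rightarrow> nat ^ 'k) \<Rightarrow> nat ^ 'k \<Rightarrow> 'v \<Rightarrow> ('v \<Rightarrow> nat \<Rightarrow> 'm set) \<Rightarrow> 'm \<Rightarrow> nat" where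
  "part_index C d B w E c =
    (THE j. j \<in> {1..num_copies C d B w (Src C c)} \<and> c \<in> E (Src C c) j)"

text \<open>The upper index of the source of the copy \<open>e\<^sup>i\<close> of an edge \<open>e\<close>. In the second case the
  path \<open>f e\<close> is rewritten as \<open>a c\<close>; the description operator is justified by the index being
  the same for every choice of \<open>f\<close>.\<close>

definition src_index ::
    "('v, 'm) category \<Rightarrow> ('m \<Rightarrow> nat ^ 'k) \<Rightarrow> nat ^ 'k \<Rightarrow> 'v \<Rightarrow> ('v \<Rightarrow> nat \<Rightarrow> 'm set)
      \<Rightarrow> 'm \<Rightarrow> nat \<Rightarrow> nat" where
  "src_index C d B w E e i =
    (if d e = B then part_index C d B w E e
     else if B_edges_from C d B (Rng C e) \<noteq> {} then
       (THE j. \<exists>f \<in> E (Rng C e) i. \<exists>a c.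
          path_equiv C d (Src C e, [e, f], Rng C f) (Src C c, [c, a], Rng C a) \<and>
          d c = B \<and> d a = d e \<and> j = part_index C d B w E c)
     else 1)"

definition limar_digraph ::
    "('v, 'm) category \<Rightarrow> ('m \<Rightarrow> nat ^ 'k) \<Rightarrow> nat ^ 'k \<Rightarrow> 'v \<Rightarrow> ('v \<Rightarrow> nat \<Rightarrow> 'm set)
      \<Rightarrow> ('v \<times> nat, 'm \<times> nat) pre_digraph" where
  "limar_digraph C d B w E =
    \<lparr>verts = (SIGMA v:Obj C. {1..num_copies C d B w v}),
     arcs = (SIGMA e:edges C d. {1..num_copies C d B w (Rng C e)}),
     tail = (\<lambda>(e, i). (Src C e, src_index C d B w E e i)),
     head = (\<lambda>(e, i). (Rng C e, i))\<rparr>"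

definition par :: "('v \<times> nat, 'm \<times> nat) path \<Rightarrow> ('v, 'm) path" where
  "par x = (fst (path_src x), map fst (path_edges x), fst (path_rng x))"

definition limar_equiv ::
    "('v, 'm) category \<Rightarrow> ('m \<Rightarrow> nat ^ 'k) \<Rightarrow> nat ^ 'k \<Rightarrow> 'v \<Rightarrow> ('v \<Rightarrow> nat \<Rightarrow> 'm set)
      \<Rightarrow> (('v \<times> nat, 'm \<times> nat) path \<times> ('v \<times> nat, 'm \<times> nat) path) set" where
  "limar_equiv C d B w E =
    {(x, y). x \<in> paths (limar_digraph C d B w E) \<and> y \<in> paths (limar_digraph C d B w E) \<and>
       path_equiv C d (par x) (par y) \<and> path_rng x = path_rng y \<and> path_src x = path_src y}"

definition limar_split ::
    "('v, 'm) category \<Rightarrow> ('m \<Rightarrow> nat ^ 'k) \<Rightarrow> nat ^ 'k \<Rightarrow> 'v \<Rightarrow> ('v \<Rightarrow> nat \<Rightarrow> 'm set)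
      \<Rightarrow> ('v \<times> nat, ('v \<times> nat, 'm \<times> nat) path set) category" where
  "limar_split C d B w E =
    quotient_category (path_category (limar_digraph C d B w E)) (limar_equiv C d B w E)"

definition limar_path_degree :: "('m \<Rightarrow> nat ^ 'k) \<Rightarrow> ('v \<times> nat, 'm \<times> nat) path \<Rightarrow> nat ^ 'k" where
  "limar_path_degree d x = (\<Sum>(e, i) \<leftarrow> path_edges x. d e)"

definition limar_degree :: "('m \<Rightarrow> nat ^ 'k) \<Rightarrow> ('v \<times> nat, 'm \<times> nat) path set \<Rightarrow> nat ^ 'k" where
  "limar_degree d X = the_elem (limar_path_degree d ` X)"

end

theory Submission
  imports Defs
begin

text \<open>
  The projection \<open>par\<close> makes the split graph a covering of the 1-skeleton in the following sense:
  once a range index \<open>i\<close> is chosen, an edge path of \<open>C\<close> has exactly one lift, because the copy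
  \<open>e\<^sup>i\<close> of an edge is named by the index of its range and determines the index of its source. If
  the index reached at the source depends only on \<open>i\<close> and on the composite of the path, then a
  class of the split is the same thing as a morphism of \<open>C\<close> together with a range index. All the
  \<open>k\<close>-graph axioms can then be read off in \<open>C\<close>: to factor a class, factor its composite, lift the
  left factor from the given range and then lift the right factor from the source so obtained. This
  formal part is \<open>quotient_k_graph\<close>. Edges of a given degree into a vertex are in bijection with
  those into its projection, which gives \<open>quotient_source_free\<close> and \<open>quotient_row_finite\<close>.

  The content is therefore the independence of the source index, \<open>path_idx_invariant\<close>. A path
  containing an edge of degree \<open>B\<close> forgets its range index at that edge, and from there on the
  defining commuting squares transport a \<open>B\<close>-edge to the source: if the composite is factored as
  \<open>m c\<close> with \<open>c\<close> of degree \<open>B\<close>, the source index is the index of the part containing \<open>c\<close>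
  (\<open>path_idx_B_tail\<close>). By unique factorization \<open>c\<close> depends only on the composite. For an arbitrary
  path with range \<open>v\<close> and range index \<open>i\<close>, prolong it by a \<open>B\<close>-edge \<open>g\<close> leaving \<open>v\<close> in the
  \<open>i\<close>-th part: every lift of \<open>g\<close> has source index \<open>i\<close>, so the source index does not change and the
  previous case applies. The edge \<open>g\<close> is missing only if \<open>v\<close> emits no \<open>B\<close>-edge, hence only for
  \<open>k \<le> 2\<close>; then a path without \<open>B\<close>-edges uses a single colour, and two such paths with the same
  composite are equal.
\<close>

section \<open>Composites of paths in the 1-skeleton\<close>

lemma sum_eq_1_iff_unit_degree:
  fixes n :: "nat ^ 'k"
  shows "(\<Sum>i\<in>UNIV. n $ i) = 1 \<longleftrightarrow> n \<in> unit_degrees"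
proof
  assume *: "(\<Sum>i\<in>UNIV. n $ i) = 1"
  then obtain i where i: "n $ i = 1" "\<forall>j. j \<noteq> i \<longrightarrow> n $ j = 0"
    by (metis UNIV_I finite_class.finite_UNIV sum_eq_1_iff)
  then have "n = axis i 1"
    by (auto simp: vec_eq_iff axis_def)
  then show "n \<in> unit_degrees"
    by (auto simp: unit_degrees_def)
next
  assume "n \<in> unit_degrees"
  then show "(\<Sum>i\<in>UNIV. n $ i) = 1"
    by (auto simp: unit_degrees_def axis_def)
qed

context k_graph
begin

abbreviation walk :: "'v \<Rightarrow> 'm list \<Rightarrow> 'v \<Rightarrow> bool" where
  "walk \<equiv> pre_digraph.awalk (skeleton C d)"

lemma edges_iff: "e \<in> edges C d \<longleftrightarrow> e \<in> Mor C \<and> d e \<in> unit_degrees"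
  unfolding edges_def mem_Collect_eq sum_eq_1_iff_unit_degree ..

lemma edge_in_Mor: "e \<in> edges C d \<Longrightarrow> e \<in> Mor C"
  by (simp add: edges_iff)

lemma wf_skeleton: "wf_digraph (skeleton C d)"
  by unfold_locales (auto simp: skeleton_def edges_def intro: Src_in_Obj Rng_in_Obj)

lemma walk_Nil: "walk u [] v \<longleftrightarrow> u = v \<and> u \<in> Obj C"
  unfolding wf_digraph.awalk_Nil_iff[OF wf_skeleton] by (auto simp: skeleton_def)

lemma walk_Cons: "walk u (e # p) v \<longleftrightarrow> e \<in> edges C d \<and> Src C e = u \<and> walk (Rng C e) p v"
  unfolding wf_digraph.awalk_Cons_iff[OF wf_skeleton] by (auto simp: skeleton_def)

lemma walk_append: "walk u (p @ q) v \<longleftrightarrow> (\<exists>z. walk u p z \<and> walk z q v)"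
  by (metis wf_digraph.awalk_appendI[OF wf_skeleton] wf_digraph.awalk_append_iff[OF wf_skeleton])

lemma walk_edges: "walk u p v \<Longrightarrow> e \<in> set p \<Longrightarrow> e \<in> edges C d"
  unfolding pre_digraph.awalk_def by (auto simp: skeleton_def)

text \<open>Degrees can be cancelled, so prescribing the degree of one factor already prescribes the
  other.\<close>

lemma factorization_right_unique:
  assumes "l \<in> Mor C" "m \<in> Mor C" "Src C l = Rng C m"
    and "l' \<in> Mor C" "m' \<in> Mor C" "Src C l' = Rng C m'"
    and "Cmp C l m = Cmp C l' m'" and "d m = d m'"
  shows "l = l' \<and> m = m'"
proof -
  have "d l + d m = d l' + d m'"
    using assms degree_Cmp by metis
  then have "d l = d l'"
    using assms(8) by simp
  moreover have "\<exists>!p. fst p \<in> Mor C \<and> snd p \<in> Mor C \<and> Src C (fst p) = Rng C (snd p) \<and>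
            Cmp C l m = Cmp C (fst p) (snd p) \<and> d (fst p) = d l \<and> d (snd p) = d m"
    by (intro unique_factorization Cmp_in_Mor degree_Cmp assms)
  ultimately have "(l, m) = (l', m')"
    using assms by (elim ex1E) (metis fst_conv snd_conv)
  then show ?thesis
    by simp
qed

lemma factorizationE:
  assumes "l \<in> Mor C" "d l = a + b"
  obtains m n where "m \<in> Mor C" "n \<in> Mor C" "Src C m = Rng C n" "l = Cmp C m n" "d m = a" "d n = b"
  using unique_factorization[OF assms] by blast

text \<open>The products of \<open>l\<close> with the identities at its range and at its source are two factorizations
  of \<open>l\<close> into factors of degree zero.\<close>

lemma degree_zero_Ident:
  assumes "l \<in> Mor C" "d l = 0"
  shows "l = Ident C (Rng C l) \<and> Src C l = Rng C l"
proof -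
  have "l = Ident C (Rng C l)"
    using factorization_right_unique[of l "Ident C (Src C l)" "Ident C (Rng C l)" l] assms
    by (simp add: Cmp_Ident_left Cmp_Ident_right Ident_in_Mor Src_in_Obj Rng_in_Obj
        Src_Ident Rng_Ident degree_Ident)
  then show ?thesis
    using assms by (metis Src_Ident Rng_in_Obj)
qed

lemma composite_snoc: "composite C (u, p @ [e], v) = Cmp C e (composite C (u, p, z))"
  by (simp add: composite_def path_src_def path_edges_def)

lemma composite_Nil: "composite C (u, [], v) = Ident C u"
  by (simp add: composite_def path_src_def path_edges_def)

lemma composite_in_Mor:
  assumes "walk u p v"
  shows "composite C (u, p, v) \<in> Mor C" "Src C (composite C (u, p, v)) = u"
    "Rng C (composite C (u, p, v)) = v" "d (composite C (u, p, v)) = sum_list (map d p)"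
proof -
  have "composite C (u, p, v) \<in> Mor C \<and> Src C (composite C (u, p, v)) = u \<and>
    Rng C (composite C (u, p, v)) = v \<and> d (composite C (u, p, v)) = sum_list (map d p)"
    using assms
  proof (induction p arbitrary: v rule: rev_induct)
    case Nil
    then show ?case
      by (auto simp: walk_Nil composite_Nil Ident_in_Mor Src_Ident Rng_Ident degree_Ident)
  next
    case (snoc e p)
    then have e: "e \<in> edges C d" "walk u p (Src C e)" "v = Rng C e"
      by (auto simp: walk_append walk_Cons walk_Nil)
    with snoc.IH[of "Src C e"] show ?case
      by (simp add: composite_snoc[where z = "Src C e"] edge_in_Mor Cmp_in_Mor Src_Cmp Rng_Cmp
          degree_Cmp add.commute)
  qed
  then show "composite C (u, p, v) \<in> Mor C" "Src C (composite C (u, p, v)) = u"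
    "Rng C (composite C (u, p, v)) = v" "d (composite C (u, p, v)) = sum_list (map d p)"
    by simp_all
qed

lemma composite_append:
  assumes "walk u p z" "walk z q v"
  shows "composite C (u, p @ q, v) = Cmp C (composite C (z, q, v)) (composite C (u, p, z))"
  using assms(2)
proof (induction q arbitrary: v rule: rev_induct)
  case Nil
  then show ?case
    using composite_in_Mor[OF assms(1)] Cmp_Ident_left[of "composite C (u, p, z)"]
    by (simp add: walk_Nil composite_Nil)
next
  case (snoc e q)
  then have e: "e \<in> edges C d" "walk z q (Src C e)" "v = Rng C e"
    by (auto simp: walk_append walk_Cons walk_Nil)
  show ?case
    using snoc.IH[OF e(2)] e composite_in_Mor[OF assms(1)] composite_in_Mor[OF e(2)]
    by (simp add: composite_snoc[where z = "Src C e"] Cmp_assoc edge_in_Mor flip: append_assoc)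
qed

lemma composite_single: "e \<in> edges C d \<Longrightarrow> composite C (Src C e, [e], v) = e"
  using composite_snoc[of "Src C e" "[]" e v "Src C e"]
  by (simp add: composite_Nil Cmp_Ident_right edge_in_Mor)

lemma composite_Cons:
  assumes "e \<in> edges C d" "walk (Rng C e) p v"
  shows "composite C (Src C e, e # p, v) = Cmp C (composite C (Rng C e, p, v)) e"
  using composite_append[of "Src C e" "[e]" "Rng C e" p v] assms
  by (simp add: composite_single walk_Cons walk_Nil Rng_in_Obj edge_in_Mor)

text \<open>Edges are split off at the range end, by induction on the total degree.\<close>

lemma ex_walk_composite:
  assumes "l \<in> Mor C"
  shows "\<exists>p. walk (Src C l) p (Rng C l) \<and> composite C (Src C l, p, Rng C l) = l"
  using assms
proof (induction "\<Sum>i\<in>UNIV. d l $ i" arbitrary: l rule: less_induct)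
  case less
  show ?case
  proof (cases "d l = 0")
    case True
    then have l: "l = Ident C (Rng C l)" "Src C l = Rng C l"
      using degree_zero_Ident less.prems by auto
    have "walk (Src C l) [] (Rng C l)" "composite C (Src C l, [], Rng C l) = l"
      using l less.prems by (simp_all add: walk_Nil Rng_in_Obj composite_Nil)
    then show ?thesis
      by blast
  next
    case False
    then obtain i where i: "d l $ i > 0"
      by (auto simp: vec_eq_iff)
    define b where "b = (\<chi> j. d l $ j - axis i 1 $ j)"
    have "d l = axis i 1 + b"
      using i by (auto simp: vec_eq_iff b_def axis_def)
    then obtain e m where em: "e \<in> Mor C" "m \<in> Mor C" "Src C e = Rng C m" "l = Cmp C e m"
        "d e = axis i 1" "d m = b"
      using factorizationE[OF less.prems] by blast
    then have e: "e \<in> edges C d"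
      by (simp add: edges_iff unit_degrees_def)
    have "d l = d e + d m"
      using em by (simp add: degree_Cmp)
    then have "(\<Sum>i\<in>UNIV. d l $ i) = (\<Sum>i\<in>UNIV. d e $ i) + (\<Sum>i\<in>UNIV. d m $ i)"
      by (simp add: sum.distrib)
    then have "(\<Sum>i\<in>UNIV. d m $ i) < (\<Sum>i\<in>UNIV. d l $ i)"
      using e by (simp add: edges_def)
    then obtain p where p: "walk (Src C m) p (Rng C m)" "composite C (Src C m, p, Rng C m) = m"
      using less.hyps em(2) by blast
    have "walk (Src C l) (p @ [e]) (Rng C l)"
      using p em e by (auto simp: walk_append walk_Cons walk_Nil Src_Cmp Rng_Cmp Rng_in_Obj)
    moreover have "composite C (Src C l, p @ [e], Rng C l) = l"
      using p em by (simp add: composite_snoc[where z = "Rng C m"] Src_Cmp)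
    ultimately show ?thesis
      by blast
  qed
qed

text \<open>The order of the colours determines the path: compare the edges at the source end and
  cancel.\<close>

lemma walk_unique_of_degrees:
  assumes "walk u p v" "walk u' q v" "composite C (u, p, v) = composite C (u', q, v)"
    and "map d p = map d q"
  shows "p = q"
  using assms
proof (induction p arbitrary: u u' q)
  case Nil
  then show ?case
    by simp
next
  case (Cons e p)
  then obtain f q' where q: "q = f # q'" "d e = d f" "map d p = map d q'"
    by auto
  have e: "e \<in> edges C d" "Src C e = u" "walk (Rng C e) p v"
    and f: "f \<in> edges C d" "Src C f = u'" "walk (Rng C f) q' v"
    using Cons.prems q by (auto simp: walk_Cons)
  have "Cmp C (composite C (Rng C e, p, v)) e = Cmp C (composite C (Rng C f, q', v)) f"
    using Cons.prems(3) e f q composite_Cons by metis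
  then have "composite C (Rng C e, p, v) = composite C (Rng C f, q', v) \<and> e = f"
    by (rule factorization_right_unique[rotated -2])
      (simp_all add: composite_in_Mor edge_in_Mor q(2) e(1,3) f(1,3))
  then show ?case
    using Cons.IH[OF e(3) f(3) _ q(3)] q(1) by blast
qed

end

section \<open>Quotients of categories lying over a k-graph\<close>

text \<open>
  A functor \<open>\<phi>\<close>, acting as \<open>\<pi>\<close> on objects, along which every morphism lifts once the range of the
  lift is prescribed. Lifts need not be unique, but all lifts of a morphism with the same range have
  the same source. Identifying them leaves exactly one lift, so the quotient is a discrete fibration
  over the \<open>k\<close>-graph and inherits its structure. The degree \<open>\<delta>\<close> is a separate parameter because
  outside the morphisms of \<open>K\<close> it may differ from the composite of \<open>\<phi>\<close> and \<open>d\<close>.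
\<close>

locale category_over_k_graph = K: small_category K + k_graph C d
  for K :: "('u, 'n) category" and C :: "('v, 'm) category" and d :: "'m \<Rightarrow> nat ^ 'k" +
  fixes \<pi> :: "'u \<Rightarrow> 'v" and \<phi> :: "'n \<Rightarrow> 'm" and \<delta> :: "'n \<Rightarrow> nat ^ 'k"
  assumes countable_Obj: "countable (Obj K)"
    and proj_Obj: "u \<in> Obj K \<Longrightarrow> \<pi> u \<in> Obj C"
    and proj_Mor: "x \<in> Mor K \<Longrightarrow> \<phi> x \<in> Mor C"
    and proj_Src: "x \<in> Mor K \<Longrightarrow> Src C (\<phi> x) = \<pi> (Src K x)"
    and proj_Rng: "x \<in> Mor K \<Longrightarrow> Rng C (\<phi> x) = \<pi> (Rng K x)"
    and proj_Ident: "u \<in> Obj K \<Longrightarrow> \<phi> (Ident K u) = Ident C (\<pi> u)"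
    and proj_Cmp: "\<lbrakk>x \<in> Mor K; y \<in> Mor K; Src K x = Rng K y\<rbrakk> \<Longrightarrow> \<phi> (Cmp K x y) = Cmp C (\<phi> x) (\<phi> y)"
    and proj_degree: "x \<in> Mor K \<Longrightarrow> \<delta> x = d (\<phi> x)"
    and lift_exists: "\<lbrakk>l \<in> Mor C; u \<in> Obj K; Rng C l = \<pi> u\<rbrakk> \<Longrightarrow> \<exists>x \<in> Mor K. \<phi> x = l \<and> Rng K x = u"
    and lift_Src_unique:
      "\<lbrakk>x \<in> Mor K; y \<in> Mor K; \<phi> x = \<phi> y; Rng K x = Rng K y\<rbrakk> \<Longrightarrow> Src K x = Src K y"
begin

definition fibre_equiv :: "('n \<times> 'n) set" where
  "fibre_equiv = {(x, y). x \<in> Mor K \<and> y \<in> Mor K \<and> \<phi> x = \<phi> y \<and> Rng K x = Rng K y}"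

abbreviation Q :: "('u, 'n set) category" where
  "Q \<equiv> quotient_category K fibre_equiv"

abbreviation Q_degree :: "'n set \<Rightarrow> nat ^ 'k" where
  "Q_degree \<equiv> \<lambda>X. the_elem (\<delta> ` X)"

definition cls :: "'n \<Rightarrow> 'n set" where
  "cls x = fibre_equiv `` {x}"

lemma mem_cls: "x \<in> Mor K \<Longrightarrow> y \<in> cls x \<longleftrightarrow> y \<in> Mor K \<and> \<phi> y = \<phi> x \<and> Rng K y = Rng K x"
  by (auto simp: cls_def fibre_equiv_def)

lemma cls_eq_iff:
  "x \<in> Mor K \<Longrightarrow> y \<in> Mor K \<Longrightarrow> cls x = cls y \<longleftrightarrow> \<phi> x = \<phi> y \<and> Rng K x = Rng K y"
  using mem_cls[of y y] mem_cls[of x y] by (auto simp: cls_def fibre_equiv_def)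

lemma the_elem_image_cls:
  assumes "x \<in> Mor K" "\<And>y. y \<in> Mor K \<Longrightarrow> \<phi> y = \<phi> x \<Longrightarrow> Rng K y = Rng K x \<Longrightarrow> f y = f x"
  shows "the_elem (f ` cls x) = f x"
proof (rule the_elem_image_unique)
  show "cls x \<noteq> {}"
    using assms(1) mem_cls[of x x] by blast
  show "f y = f x" if "y \<in> cls x" for y
    using assms that mem_cls[of x y] by blast
qed

lemma Obj_Q: "Obj Q = Obj K"
  by (simp add: quotient_category_def)

lemma Mor_Q: "Mor Q = cls ` Mor K"
  by (auto simp: quotient_category_def quotient_def cls_def)

lemma Src_Q: "x \<in> Mor K \<Longrightarrow> Src Q (cls x) = Src K x"
  unfolding quotient_category_def category.simps
  by (rule the_elem_image_cls) (auto intro: lift_Src_unique)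

lemma Rng_Q: "x \<in> Mor K \<Longrightarrow> Rng Q (cls x) = Rng K x"
  unfolding quotient_category_def category.simps by (rule the_elem_image_cls)

lemma Ident_Q: "Ident Q u = cls (Ident K u)"
  by (simp add: quotient_category_def cls_def)

lemma Q_degree_cls: "x \<in> Mor K \<Longrightarrow> Q_degree (cls x) = d (\<phi> x)"
  by (subst the_elem_image_cls) (simp_all add: proj_degree)

text \<open>Representatives of composable classes are themselves composable: the source of a
  representative depends only on its class by \<open>lift_Src_unique\<close>.\<close>

lemma Cmp_Q:
  assumes "x \<in> Mor K" "y \<in> Mor K" "Src K x = Rng K y"
  shows "Cmp Q (cls x) (cls y) = cls (Cmp K x y)"
proof -
  have *: "cls (Cmp K x' y') = cls (Cmp K x y)" if "x' \<in> cls x" "y' \<in> cls y" for x' y'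
  proof -
    have x': "x' \<in> Mor K" "\<phi> x' = \<phi> x" "Rng K x' = Rng K x"
      and y': "y' \<in> Mor K" "\<phi> y' = \<phi> y" "Rng K y' = Rng K y"
      using that assms by (auto simp: mem_cls)
    moreover have "Src K x' = Rng K y'"
      using x' y' assms lift_Src_unique by metis
    ultimately show ?thesis
      using assms by (simp add: cls_eq_iff K.Cmp_in_Mor K.Rng_Cmp proj_Cmp)
  qed
  have "x \<in> cls x" "y \<in> cls y"
    using assms by (auto simp: mem_cls)
  then have "(\<Union>x'\<in>cls x. \<Union>y'\<in>cls y. cls (Cmp K x' y')) = cls (Cmp K x y)"
    using * by blast
  then show ?thesis
    by (simp add: quotient_category_def cls_def)
qed

lemma quotient_small_category: "small_category Q"
proof (unfold_locales, goal_cases)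
  case (6 l m)
  then show ?case by (auto simp: Mor_Q Src_Q Rng_Q Cmp_Q K.Cmp_in_Mor)
next
  case (11 l m n)
  then show ?case
    by (auto simp: Mor_Q Src_Q Rng_Q Cmp_Q K.Cmp_in_Mor K.Src_Cmp K.Rng_Cmp K.Cmp_assoc)
qed (auto simp: Obj_Q Mor_Q Src_Q Rng_Q Ident_Q Cmp_Q K.Src_in_Obj K.Rng_in_Obj K.Ident_in_Mor
    K.Src_Ident K.Rng_Ident K.Cmp_in_Mor K.Src_Cmp K.Rng_Cmp K.Cmp_Ident_left K.Cmp_Ident_right)

text \<open>A class is determined by the projection and the range of its members.\<close>

lemma quotient_countable: "countable (Mor Q)"
proof -
  have "countable ((\<lambda>(l, u). {x \<in> Mor K. \<phi> x = l \<and> Rng K x = u}) ` (Mor C \<times> Obj K))"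
    by (intro countable_image countable_SIGMA countable_Mor countable_Obj)
  moreover have "Mor Q \<subseteq> (\<lambda>(l, u). {x \<in> Mor K. \<phi> x = l \<and> Rng K x = u}) ` (Mor C \<times> Obj K)"
  proof
    fix X assume "X \<in> Mor Q"
    then obtain x where x: "x \<in> Mor K" "X = cls x"
      by (auto simp: Mor_Q)
    then have "X = (\<lambda>(l, u). {x \<in> Mor K. \<phi> x = l \<and> Rng K x = u}) (\<phi> x, Rng K x)"
      by (auto simp: mem_cls)
    then show "X \<in> (\<lambda>(l, u). {x \<in> Mor K. \<phi> x = l \<and> Rng K x = u}) ` (Mor C \<times> Obj K)"
      using x by (blast intro: proj_Mor K.Rng_in_Obj)
  qed
  ultimately show ?thesis
    by (rule countable_subset[rotated])
qed

text \<open>The projection of the class factors uniquely as \<open>m n\<close>. The left factor must be the lift \<open>y\<close> of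
  \<open>m\<close> with the given range, and the right factor the lift \<open>z\<close> of \<open>n\<close> whose range is the source of
  \<open>y\<close>.\<close>

lemma quotient_unique_factorization:
  assumes "X \<in> Mor Q" "Q_degree X = a + b"
  shows "\<exists>!p. fst p \<in> Mor Q \<and> snd p \<in> Mor Q \<and> Src Q (fst p) = Rng Q (snd p) \<and>
    X = Cmp Q (fst p) (snd p) \<and> Q_degree (fst p) = a \<and> Q_degree (snd p) = b"
proof -
  obtain x where x: "x \<in> Mor K" "X = cls x"
    using assms by (auto simp: Mor_Q)
  then obtain m n where mn: "m \<in> Mor C" "n \<in> Mor C" "Src C m = Rng C n" "\<phi> x = Cmp C m n"
      "d m = a" "d n = b"
    using assms factorizationE[of "\<phi> x" a b] by (auto simp: Q_degree_cls proj_Mor)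
  have "Rng C m = \<pi> (Rng K x)"
    using mn x proj_Rng Rng_Cmp by metis
  then obtain y where y: "y \<in> Mor K" "\<phi> y = m" "Rng K y = Rng K x"
    using lift_exists mn(1) x K.Rng_in_Obj by blast
  have "Rng C n = \<pi> (Src K y)"
    using mn y proj_Src by metis
  then obtain z where z: "z \<in> Mor K" "\<phi> z = n" "Rng K z = Src K y"
    using lift_exists mn(2) y K.Src_in_Obj by blast
  show ?thesis
  proof (intro ex1I[of _ "(cls y, cls z)"])
    show "fst (cls y, cls z) \<in> Mor Q \<and> snd (cls y, cls z) \<in> Mor Q \<and>
      Src Q (fst (cls y, cls z)) = Rng Q (snd (cls y, cls z)) \<and>
      X = Cmp Q (fst (cls y, cls z)) (snd (cls y, cls z)) \<and>
      Q_degree (fst (cls y, cls z)) = a \<and> Q_degree (snd (cls y, cls z)) = b"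
      using x y z mn
      by (auto simp: Mor_Q Src_Q Rng_Q Cmp_Q Q_degree_cls cls_eq_iff K.Cmp_in_Mor K.Rng_Cmp proj_Cmp)
  next
    fix p
    assume p: "fst p \<in> Mor Q \<and> snd p \<in> Mor Q \<and> Src Q (fst p) = Rng Q (snd p) \<and>
      X = Cmp Q (fst p) (snd p) \<and> Q_degree (fst p) = a \<and> Q_degree (snd p) = b"
    then obtain y' z' where y': "y' \<in> Mor K" "fst p = cls y'" and z': "z' \<in> Mor K" "snd p = cls z'"
      by (auto simp: Mor_Q)
    have s: "Src K y' = Rng K z'"
      using p y' z' by (simp add: Src_Q Rng_Q)
    have "cls x = cls (Cmp K y' z')"
      using p x y' z' s by (simp add: Cmp_Q)
    then have eq: "\<phi> x = Cmp C (\<phi> y') (\<phi> z')" "Rng K x = Rng K y'"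
      using x y' z' s by (simp_all add: cls_eq_iff K.Cmp_in_Mor K.Rng_Cmp proj_Cmp)
    have "d (\<phi> z') = d n"
      using p z' mn by (simp add: Q_degree_cls)
    moreover have "Src C (\<phi> y') = Rng C (\<phi> z')"
      using s y' z' by (simp add: proj_Src proj_Rng)
    ultimately have "\<phi> y' = m" "\<phi> z' = n"
      using factorization_right_unique[of "\<phi> y'" "\<phi> z'" m n] eq mn y' z' by (auto simp: proj_Mor)
    moreover from this have "Src K y' = Src K y"
      using lift_Src_unique y' y eq by metis
    ultimately have "cls y' = cls y" "cls z' = cls z"
      using y y' z z' eq s by (simp_all add: cls_eq_iff)
    then show "p = (cls y, cls z)"
      using y' z' by (simp add: prod_eq_iff)
  qed
qed

lemma quotient_k_graph: "k_graph Q Q_degree"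
proof -
  interpret Q: small_category Q
    by (rule quotient_small_category)
  show ?thesis
  proof (unfold_locales, goal_cases)
    case 1
    show ?case by (rule quotient_countable)
  next
    case (2 v)
    then show ?case
      by (simp add: Obj_Q Ident_Q Q_degree_cls K.Ident_in_Mor proj_Ident degree_Ident proj_Obj)
  next
    case (3 l m)
    then show ?case
      by (auto simp: Mor_Q Src_Q Rng_Q Cmp_Q Q_degree_cls K.Cmp_in_Mor proj_Cmp degree_Cmp proj_Mor
          proj_Src proj_Rng)
  next
    case (4 l a b)
    then show ?case by (rule quotient_unique_factorization)
  qed
qed

lemma quotient_source_free:
  assumes "source_free C d"
  shows "source_free Q Q_degree"
  unfolding source_free_def
proof (intro ballI)
  fix u and n :: "nat ^ 'k" assume u: "u \<in> Obj Q" and n: "n \<in> unit_degrees"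
  then obtain l where "l \<in> Mor C" "d l = n" "Rng C l = \<pi> u"
    using assms proj_Obj by (fastforce simp: source_free_def mors_into_def Obj_Q)
  then obtain x where "x \<in> Mor K" "d (\<phi> x) = n" "Rng K x = u"
    using lift_exists u by (auto simp: Obj_Q)
  then have "cls x \<in> mors_into Q Q_degree u n"
    by (simp add: mors_into_def Mor_Q Q_degree_cls Rng_Q)
  then show "mors_into Q Q_degree u n \<noteq> {}"
    by blast
qed

lemma quotient_row_finite:
  assumes "row_finite C d"
  shows "row_finite Q Q_degree"
  unfolding row_finite_def
proof (intro ballI)
  fix u and n :: "nat ^ 'k" assume u: "u \<in> Obj Q" and n: "n \<in> unit_degrees"
  then have "finite (mors_into C d (\<pi> u) n)"
    using assms proj_Obj by (auto simp: row_finite_def Obj_Q)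
  moreover have "mors_into Q Q_degree u n \<subseteq>
      (\<lambda>l. {x \<in> Mor K. \<phi> x = l \<and> Rng K x = u}) ` mors_into C d (\<pi> u) n"
  proof
    fix X assume "X \<in> mors_into Q Q_degree u n"
    then obtain x where x: "x \<in> Mor K" "X = cls x" "d (\<phi> x) = n" "Rng K x = u"
      by (auto simp: mors_into_def Mor_Q Q_degree_cls Rng_Q)
    have "X = {y \<in> Mor K. \<phi> y = \<phi> x \<and> Rng K y = u}"
      using x by (auto simp: mem_cls)
    moreover have "\<phi> x \<in> mors_into C d (\<pi> u) n"
      using x by (auto simp: mors_into_def proj_Mor proj_Rng)
    ultimately show "X \<in> (\<lambda>l. {x \<in> Mor K. \<phi> x = l \<and> Rng K x = u}) ` mors_into C d (\<pi> u) n"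
      by blast
  qed
  ultimately show "finite (mors_into Q Q_degree u n)"
    by (meson finite_surj)
qed

end

lemma path_category_small_category:
  assumes "wf_digraph G"
  shows "small_category (path_category G)"
proof -
  have obj: "u \<in> verts G \<and> v \<in> verts G" if "pre_digraph.awalk G u p v" for u p v
    using wf_digraph.awalk_hd_in_verts[OF assms that] wf_digraph.awalk_last_in_verts[OF assms that]
    by simp
  have nil: "pre_digraph.awalk G v [] v" if "v \<in> verts G" for v
    using that by (simp add: wf_digraph.awalk_Nil_iff[OF assms])
  show ?thesis
    by unfold_locales
      (auto simp: path_category_def paths_def path_src_def path_rng_def path_edges_def
        dest: obj intro: nil wf_digraph.awalk_appendI[OF assms])
qed


section \<open>The source index of a path\<close>

locale limar_data = k_graph C d
  for C :: "('v, 'm) category" and d :: "'m \<Rightarrow> nat ^ 'k" +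
  fixes B :: "nat ^ 'k" and w :: 'v and E :: "'v \<Rightarrow> nat \<Rightarrow> 'm set"
  assumes B_unit: "B \<in> unit_degrees"
    and w_emits: "at_least_two (B_edges_from C d B w)"
    and finite_emission: "v \<in> split_verts C d B w \<Longrightarrow> finite (B_edges_from C d B v)"
    and partition: "limar_partition C d B w E"
    and no_sinks: "CARD('k) \<ge> 3 \<Longrightarrow> sink_free C d B"
begin

abbreviation emits :: "'v \<Rightarrow> 'm set" where
  "emits \<equiv> B_edges_from C d B"

abbreviation copies :: "'v \<Rightarrow> nat set" where
  "copies v \<equiv> {1..num_copies C d B w v}"

abbreviation index :: "'m \<Rightarrow> nat" where
  "index \<equiv> part_index C d B w E"

abbreviation src_idx :: "'m \<Rightarrow> nat \<Rightarrow> nat" where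
  "src_idx \<equiv> src_index C d B w E"

lemma emits_iff: "f \<in> emits v \<longleftrightarrow> f \<in> Mor C \<and> d f = B \<and> Src C f = v"
  using B_unit by (auto simp: B_edges_from_def edges_iff)

text \<open>Every vertex that is split emits at least two edges of degree \<open>B\<close>, and only finitely many, so
  the cardinality in \<^const>\<open>num_copies\<close> is not zero.\<close>

lemma num_copies_pos: "1 \<in> copies v"
proof (cases "v \<in> split_verts C d B w")
  case True
  then have "at_least_two (emits v)"
    by (cases rule: split_verts.cases) (auto simp: w_emits)
  then show ?thesis
    using True finite_emission by (auto simp: at_least_two_def num_copies_def)
qed (simp add: num_copies_def)

lemma partition_unique:
  assumes "f \<in> emits v"
  shows "\<exists>!i. i \<in> copies v \<and> f \<in> E v i"
proof -
  have "v \<in> Obj C"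
    using assms by (auto simp: emits_iff Src_in_Obj)
  then have "(\<Union>i \<in> copies v. E v i) = emits v" "disjoint_family_on (E v) (copies v)"
    using assms partition unfolding limar_partition_def by blast+
  moreover from this obtain i where "i \<in> copies v" "f \<in> E v i"
    using assms by blast
  ultimately show ?thesis
    unfolding disjoint_family_on_def by blast
qed

lemma index_in_copies: "f \<in> emits v \<Longrightarrow> index f \<in> copies v"
  and mem_index: "f \<in> emits v \<Longrightarrow> f \<in> E v (index f)"
  using theI'[OF partition_unique[of f v]] by (simp_all add: part_index_def emits_iff)

lemma index_eqI: "f \<in> emits v \<Longrightarrow> i \<in> copies v \<Longrightarrow> f \<in> E v i \<Longrightarrow> index f = i"
  using partition_unique index_in_copies mem_index by blast

lemma ex_index:
  assumes "emits v \<noteq> {}" "i \<in> copies v"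
  shows "\<exists>f \<in> emits v. index f = i"
proof -
  have "v \<in> Obj C"
    using assms by (auto simp: emits_iff Src_in_Obj)
  then have "(\<Union>i \<in> copies v. E v i) = emits v" "E v i \<noteq> {}"
    using assms partition unfolding limar_partition_def by blast+
  then show ?thesis
    using assms(2) index_eqI by blast
qed

text \<open>A split vertex has as many parts as it emits edges of degree \<open>B\<close>, so each part is a
  singleton.\<close>

lemma index_inj_on_split_verts:
  assumes "v \<in> split_verts C d B w"
  shows "inj_on index (emits v)"
proof (rule eq_card_imp_inj_on)
  show "finite (emits v)"
    using assms finite_emission by simp
  have "index ` emits v = copies v" if "emits v \<noteq> {}"
    using index_in_copies ex_index[OF that] by blast
  then show "card (index ` emits v) = card (emits v)"
    using assms by (cases "emits v = {}") (auto simp: num_copies_def)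
qed

text \<open>
  The choice of \<open>f\<close> in its part is harmless. If \<open>s(e)\<close> is not split, it carries only one index. If
  it is split and \<open>r(e)\<close> emits two different \<open>B\<close>-edges, then \<open>r(e)\<close> is split as well, because the split
  vertices are closed under edges of degree other than \<open>B\<close> into vertices of this kind; its parts are
  then singletons and leave no choice.
\<close>

lemma B_tail_index_well_defined:
  assumes e: "e \<in> edges C d" "d e \<noteq> B"
    and f: "f \<in> emits (Rng C e)" and f': "f' \<in> emits (Rng C e)" "index f = index f'"
    and c: "c \<in> emits (Src C e)" "a \<in> Mor C" "Src C a = Rng C c" "Cmp C f e = Cmp C a c"
    and c': "c' \<in> emits (Src C e)" "a' \<in> Mor C" "Src C a' = Rng C c'" "Cmp C f' e = Cmp C a' c'"
  shows "index c = index c'"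
proof (cases "Src C e \<in> split_verts C d B w")
  case False
  then have "num_copies C d B w (Src C e) = 1"
    by (simp add: num_copies_def)
  then show ?thesis
    using index_in_copies[OF c(1)] index_in_copies[OF c'(1)] by simp
next
  case True
  have "f = f'"
  proof (rule ccontr)
    assume ne: "f \<noteq> f'"
    have "at_least_two (emits (Rng C e))"
      unfolding at_least_two_def
    proof (rule disjCI)
      assume "\<not> 2 \<le> card (emits (Rng C e))"
      show "infinite (emits (Rng C e))"
      proof
        assume "finite (emits (Rng C e))"
        then have "card {f, f'} \<le> card (emits (Rng C e))"
          using f f' by (intro card_mono) auto
        with ne \<open>\<not> 2 \<le> card (emits (Rng C e))\<close> show False
          by simp
      qed
    qed
    with True e have "Rng C e \<in> split_verts C d B w"
      by (intro split_verts.step[OF True e(1)]) (auto simp: edges_iff)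
    then show False
      using index_inj_on_split_verts f f' ne by (auto dest: inj_onD)
  qed
  then have "c = c'"
    using factorization_right_unique[of a c a' c'] c c' by (simp add: emits_iff)
  then show ?thesis
    by simp
qed

lemma path_equiv_square:
  assumes "e \<in> edges C d" "f \<in> emits (Rng C e)"
  shows "path_equiv C d (Src C e, [e, f], Rng C f) (Src C c, [c, a], Rng C a) \<longleftrightarrow>
    c \<in> edges C d \<and> a \<in> edges C d \<and> Src C a = Rng C c \<and> Cmp C f e = Cmp C a c"
proof -
  have f: "f \<in> edges C d" "Src C f = Rng C e"
    using assms by (auto simp: B_edges_from_def)
  have square: "composite C (Src C x, [x, y], Rng C y) = Cmp C y x" if "x \<in> edges C d" for x y
    using composite_snoc[of "Src C x" "[x]" y "Rng C y" "Rng C x"] composite_single that by simp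
  show ?thesis
    using assms(1) f
    by (auto simp: path_equiv_def paths_def walk_Cons walk_Nil square Rng_in_Obj edge_in_Mor)
qed

text \<open>The description operator in \<^const>\<open>src_index\<close> may thus be evaluated on any commuting square
  \<open>f e = a c\<close>.\<close>

lemma src_idx_square:
  assumes e: "e \<in> edges C d" "d e \<noteq> B" and f: "f \<in> emits (Rng C e)"
    and c: "c \<in> Mor C" "d c = B" "a \<in> Mor C" "Src C a = Rng C c" "Cmp C f e = Cmp C a c"
  shows "src_idx e (index f) = index c"
proof -
  have emits: "c \<in> emits (Src C e)" if "c \<in> Mor C" "d c = B" "a \<in> Mor C" "Src C a = Rng C c"
      "f \<in> emits (Rng C e)" "Cmp C f e = Cmp C a c" for f a c
  proof -
    have "Src C c = Src C e"
      using that e by (metis Src_Cmp edge_in_Mor emits_iff)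
    then show ?thesis
      using that by (simp add: emits_iff)
  qed
  let ?P = "\<lambda>j. \<exists>f' \<in> E (Rng C e) (index f). \<exists>a c.
          path_equiv C d (Src C e, [e, f'], Rng C f') (Src C c, [c, a], Rng C a) \<and>
          d c = B \<and> d a = d e \<and> j = index c"
  have "(THE j. ?P j) = index c"
  proof (rule the_equality)
    have "d f + d e = d a + d c"
      using c e f by (metis degree_Cmp edge_in_Mor emits_iff)
    then have da: "d a = d e"
      using c f by (simp add: emits_iff add.commute)
    then have "path_equiv C d (Src C e, [e, f], Rng C f) (Src C c, [c, a], Rng C a)"
      using c e f B_unit by (simp add: path_equiv_square edges_iff)
    then show "?P (index c)"
      using da c mem_index[OF f] by blast
  next
    fix j assume "?P j"
    then obtain f' a' c' where f': "f' \<in> E (Rng C e) (index f)"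
      and path: "path_equiv C d (Src C e, [e, f'], Rng C f') (Src C c', [c', a'], Rng C a')"
      and c': "d c' = B" "j = index c'"
      by blast
    have "Rng C e \<in> Obj C" "emits (Rng C e) \<noteq> {}"
      using e f by (auto simp: Rng_in_Obj edge_in_Mor)
    then have "(\<Union>i \<in> copies (Rng C e). E (Rng C e) i) = emits (Rng C e)"
      using partition unfolding limar_partition_def by blast
    then have f'': "f' \<in> emits (Rng C e)"
      using f' index_in_copies[OF f] by blast
    then have "index f' = index f"
      using f' index_in_copies[OF f] by (intro index_eqI)
    moreover have sq: "c' \<in> Mor C" "a' \<in> Mor C" "Src C a' = Rng C c'" "Cmp C f' e = Cmp C a' c'"
      using path path_equiv_square[OF e(1) f''] by (auto simp: edge_in_Mor)
    ultimately have "index c' = index c"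
      by (intro B_tail_index_well_defined[OF e f'' f _ emits[OF sq(1) c'(1) sq(2,3) f'' sq(4)] sq(2-4)
            emits[OF c(1-4) f c(5)] c(3-5)])
    with c'(2) show "j = index c"
      by simp
  qed
  moreover have "emits (Rng C e) \<noteq> {}"
    using f by blast
  ultimately show ?thesis
    using e(2) by (simp add: src_index_def)
qed

lemma src_idx_in_copies:
  assumes e: "e \<in> edges C d" and i: "i \<in> copies (Rng C e)"
  shows "src_idx e i \<in> copies (Src C e)"
proof (cases "d e = B")
  case True
  then have "src_idx e i = index e" "e \<in> emits (Src C e)"
    using e by (auto simp: src_index_def B_edges_from_def)
  then show ?thesis
    using index_in_copies[of e "Src C e"] by simp
next
  case False
  show ?thesis
  proof (cases "emits (Rng C e) = {}")
    case True
    then have "src_idx e i = 1"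
      using False by (simp add: src_index_def)
    then show ?thesis
      using num_copies_pos by simp
  next
    case nonempty: False
    then obtain f where f: "f \<in> emits (Rng C e)" "index f = i"
      using ex_index i by blast
    have fe: "f \<in> Mor C" "e \<in> Mor C" "Src C f = Rng C e"
      using e f by (auto simp: emits_iff edge_in_Mor)
    moreover have "d (Cmp C f e) = d e + B"
      using fe f by (simp add: degree_Cmp emits_iff add.commute)
    ultimately obtain a c where ac: "a \<in> Mor C" "c \<in> Mor C" "Src C a = Rng C c"
        "Cmp C f e = Cmp C a c" "d a = d e" "d c = B"
      using factorizationE[of "Cmp C f e" "d e" B] Cmp_in_Mor by metis
    have "Src C c = Src C e"
      using ac fe by (metis Src_Cmp)
    then have "c \<in> emits (Src C e)"
      using ac by (simp add: emits_iff)
    then show ?thesis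
      using src_idx_square[OF e False f(1) ac(2,6,1,3,4)] f index_in_copies[of c] by simp
  qed
qed

text \<open>Edges are listed from source to range, so a right fold carries the index from the range of the
  path back to its source.\<close>

abbreviation path_idx :: "'m list \<Rightarrow> nat \<Rightarrow> nat" where
  "path_idx \<equiv> foldr src_idx"

lemma path_idx_in_copies: "walk u p v \<Longrightarrow> i \<in> copies v \<Longrightarrow> path_idx p i \<in> copies u"
proof (induction p arbitrary: u)
  case Nil
  then show ?case
    by (simp add: walk_Nil)
next
  case (Cons e p)
  then have "e \<in> edges C d" "Src C e = u" "path_idx p i \<in> copies (Rng C e)"
    by (auto simp: walk_Cons)
  then show ?case
    using src_idx_in_copies by fastforce
qed

text \<open>
  Induction at the source end. If the first edge has degree \<open>B\<close>, it is \<open>c\<close> itself and its copies all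
  have source index \<open>index c\<close>. Otherwise the remaining path still contains a \<open>B\<close>-edge and ends, towards the
  source, in a factor \<open>c'\<close> of degree \<open>B\<close>; the first edge pushes its index through the square
  \<open>c' f = a c\<close>. The range index \<open>i\<close> is lost on the way.
\<close>

lemma path_idx_B_tail:
  assumes "walk u p v" "e \<in> set p" "d e = B"
    and "composite C (u, p, v) = Cmp C m c" "m \<in> Mor C" "c \<in> Mor C" "Src C m = Rng C c" "d c = B"
  shows "path_idx p i = index c"
  using assms
proof (induction p arbitrary: u m c)
  case Nil
  then show ?case
    by simp
next
  case (Cons f p)
  then have f: "f \<in> edges C d" "Src C f = u" "walk (Rng C f) p v"
    by (auto simp: walk_Cons)
  define l where "l = composite C (Rng C f, p, v)"
  have l: "l \<in> Mor C" "Src C l = Rng C f" "d l = sum_list (map d p)"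
    using composite_in_Mor[OF f(3)] by (simp_all add: l_def)
  have lf: "Cmp C l f = Cmp C m c"
    using Cons.prems(4) composite_Cons[OF f(1,3)] f(2) by (simp add: l_def)
  show ?case
  proof (cases "d f = B")
    case True
    then have "f = c"
      using factorization_right_unique[of l f m c] l f lf Cons.prems by (simp add: edge_in_Mor)
    then show ?thesis
      using True by (simp add: src_index_def)
  next
    case False
    then have "e \<in> set p"
      using Cons.prems by auto
    then obtain ps qs where "p = ps @ e # qs"
      by (meson split_list)
    then have "d l = sum_list (map d (ps @ qs)) + B"
      using l Cons.prems by (simp add: ac_simps)
    then obtain m' c' where m': "m' \<in> Mor C" "c' \<in> Mor C" "Src C m' = Rng C c'" "l = Cmp C m' c'"
        "d c' = B"
      using factorizationE[OF l(1)] by metis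
    have IH: "path_idx p i = index c'"
      using Cons.IH[OF f(3) \<open>e \<in> set p\<close> Cons.prems(3) _ m'(1-3,5)] m'(4) by (simp add: l_def)
    have c'f: "Src C c' = Rng C f" "f \<in> Mor C"
      using m' l f by (metis Src_Cmp, simp add: edge_in_Mor)
    then have "d (Cmp C c' f) = d f + B"
      using m' by (simp add: degree_Cmp add.commute)
    then obtain a c'' where a: "a \<in> Mor C" "c'' \<in> Mor C" "Src C a = Rng C c''"
        "Cmp C c' f = Cmp C a c''" "d c'' = B"
      using factorizationE[of "Cmp C c' f" "d f" B] Cmp_in_Mor[OF m'(2) c'f(2,1)] by metis
    have m'a: "Src C m' = Rng C a"
      using a m' c'f by (metis Rng_Cmp)
    have "Cmp C (Cmp C m' a) c'' = Cmp C m c"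
      using lf m' a m'a c'f by (simp add: Cmp_assoc)
    moreover have "Cmp C m' a \<in> Mor C" "Src C (Cmp C m' a) = Rng C c''"
      using a m'(1) m'a by (simp_all add: Cmp_in_Mor Src_Cmp)
    ultimately have "c'' = c"
      using factorization_right_unique[of "Cmp C m' a" c'' m c] a(2,5) Cons.prems(5-8) by simp
    moreover have "c' \<in> emits (Rng C f)"
      using m' c'f by (simp add: emits_iff)
    then have "src_idx f (index c') = index c''"
      using src_idx_square[OF f(1) False _ a(2,5,1,3,4)] by simp
    ultimately show ?thesis
      using IH by simp
  qed
qed

lemma path_idx_eq_of_B_edge:
  assumes "walk u p v" "walk u q v" "composite C (u, p, v) = composite C (u, q, v)"
    and "e \<in> set p" "d e = B" "f \<in> set q" "d f = B"
  shows "path_idx p i = path_idx q j"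
proof -
  obtain ps qs where "p = ps @ e # qs"
    using assms by (meson split_list)
  then have "d (composite C (u, p, v)) = sum_list (map d (ps @ qs)) + B"
    using assms composite_in_Mor[OF assms(1)] by (simp add: ac_simps)
  then obtain m c where "m \<in> Mor C" "c \<in> Mor C" "Src C m = Rng C c"
      "composite C (u, p, v) = Cmp C m c" "d c = B"
    using factorizationE composite_in_Mor(1)[OF assms(1)] by metis
  then show ?thesis
    using path_idx_B_tail[OF assms(1,4,5)] path_idx_B_tail[OF assms(2,6,7)] assms(3) by metis
qed

text \<open>Whether a path contains a \<open>B\<close>-edge is visible in its degree, hence in its composite.\<close>

lemma sum_list_degree_at_B:
  assumes "B = axis b 1" "\<And>e. e \<in> set p \<Longrightarrow> e \<in> edges C d"
  shows "sum_list (map d p) $ b = 0 \<longleftrightarrow> (\<forall>e \<in> set p. d e \<noteq> B)"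
  using assms(2)
proof (induction p)
  case (Cons e p)
  then have "d e \<in> unit_degrees"
    by (simp add: edges_iff)
  then obtain j where "d e = axis j 1"
    by (auto simp: unit_degrees_def)
  then have "d e $ b = 0 \<longleftrightarrow> d e \<noteq> B"
    using assms(1) by (auto simp: axis_eq_axis) (auto simp: axis_def)
  then show ?case
    using Cons by simp
qed simp

text \<open>Prolonging both paths by the same \<open>B\<close>-edge at the range reduces the claim to paths that contain
  a \<open>B\<close>-edge. When the range emits no such edge, the absence of sinks for \<open>k \<ge> 3\<close> leaves at most two
  colours.\<close>

lemma path_idx_invariant:
  assumes p: "walk u p v" and q: "walk u q v"
    and eq: "composite C (u, p, v) = composite C (u, q, v)" and i: "i \<in> copies v"
  shows "path_idx p i = path_idx q i"
proof (cases "emits v = {}")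
  case False
  then obtain g where g: "g \<in> emits v" "index g = i"
    using ex_index i by blast
  then have g': "g \<in> edges C d" "d g = B" "Src C g = v"
    by (auto simp: B_edges_from_def)
  \<comment> \<open>The source index of a copy of \<open>g\<close> is \<open>index g = i\<close>, whatever the range index of the copy. The
    number \<open>i\<close> used at the range of \<open>g\<close> is therefore arbitrary and need not be an index there.\<close>
  have snoc: "path_idx (r @ [g]) i = path_idx r i" for r
    using g g' by (simp add: src_index_def)
  have walk: "walk u (r @ [g]) (Rng C g)" if "walk u r v" for r
    using that g' by (auto simp: walk_append walk_Cons walk_Nil Rng_in_Obj edge_in_Mor)
  have "composite C (u, p @ [g], Rng C g) = composite C (u, q @ [g], Rng C g)"
    using eq by (simp add: composite_snoc[where z = v])
  then have "path_idx (p @ [g]) i = path_idx (q @ [g]) i"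
    using path_idx_eq_of_B_edge[OF walk[OF p] walk[OF q], of g g i i] g' by simp
  then show ?thesis
    by (simp only: snoc)
next
  case no_B: True
  obtain b where b: "B = axis b 1"
    using B_unit by (auto simp: unit_degrees_def)
  have deg: "sum_list (map d p) = sum_list (map d q)"
    using composite_in_Mor(4)[OF p] composite_in_Mor(4)[OF q] eq by simp
  show ?thesis
  proof (cases "\<exists>e \<in> set p. d e = B")
    case True
    then have "\<exists>f \<in> set q. d f = B"
      using sum_list_degree_at_B[OF b] walk_edges[OF p] walk_edges[OF q] deg by metis
    with True show ?thesis
      using path_idx_eq_of_B_edge[OF p q eq] by blast
  next
    case False
    then have False': "\<not> (\<exists>f \<in> set q. d f = B)"
      using sum_list_degree_at_B[OF b] walk_edges[OF p] walk_edges[OF q] deg by metis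
    have "v \<in> Obj C"
      using composite_in_Mor(1,3)[OF p] Rng_in_Obj by metis
    then have "\<not> sink_free C d B"
      using no_B by (auto simp: sink_free_def B_edges_from_def)
    then have small: "CARD('k) \<le> 2"
      using no_sinks by linarith
    have "card (UNIV - {b}) \<le> 1"
      using small by (simp add: card_Diff_singleton)
    then have other: "x = y" if "x \<noteq> b" "y \<noteq> b" for x y :: 'k
      using that card_le_Suc0_iff_eq[of "UNIV - {b}"] by auto
    \<comment> \<open>At most one colour besides \<open>B\<close> is left, so both paths are monochromatic.\<close>
    have same: "d e = d f" if "e \<in> edges C d" "f \<in> edges C d" "d e \<noteq> B" "d f \<noteq> B" for e f
    proof -
      obtain x y where "d e = axis x 1" "d f = axis y 1"
        using \<open>e \<in> edges C d\<close> \<open>f \<in> edges C d\<close> by (auto simp: edges_iff unit_degrees_def)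
      then show ?thesis
        using that b other by metis
    qed
    have len: "(\<Sum>i\<in>UNIV. sum_list (map d r) $ i) = length r"
      if "\<And>e. e \<in> set r \<Longrightarrow> e \<in> edges C d" for r
      using that by (induction r) (auto simp: sum.distrib edges_def)
    have "length p = length q"
      using len walk_edges[OF p] walk_edges[OF q] deg by metis
    then have "map d p = map d q"
      using walk_edges[OF p] walk_edges[OF q] False False' same
      by (intro nth_equalityI) auto
    then show ?thesis
      using walk_unique_of_degrees[OF p q eq] by simp
  qed
qed

section \<open>Lifting paths to the split graph\<close>

abbreviation G_L :: "('v \<times> nat, 'm \<times> nat) pre_digraph" where
  "G_L \<equiv> limar_digraph C d B w E"

fun lift_path :: "'m list \<Rightarrow> nat \<Rightarrow> ('m \<times> nat) list" where
  "lift_path [] i = []"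
| "lift_path (e # p) i = (e, path_idx p i) # lift_path p i"

lemma limar_digraph_sel:
  "verts G_L = (SIGMA v:Obj C. copies v)"
  "arcs G_L = (SIGMA e:edges C d. copies (Rng C e))"
  "tail G_L (e, i) = (Src C e, src_idx e i)"
  "head G_L (e, i) = (Rng C e, i)"
  by (simp_all add: limar_digraph_def)

lemma wf_limar_digraph: "wf_digraph G_L"
proof
  fix x assume x: "x \<in> arcs G_L"
  then obtain e i where "x = (e, i)" "e \<in> edges C d" "i \<in> copies (Rng C e)"
    by (auto simp: limar_digraph_sel)
  then show "tail G_L x \<in> verts G_L" "head G_L x \<in> verts G_L"
    using src_idx_in_copies[of e i]
    by (simp_all add: limar_digraph_sel edge_in_Mor Src_in_Obj Rng_in_Obj)
qed

text \<open>The index of the range and the projected path determine a path of the split graph.\<close>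

lemma split_walk_iff:
  "pre_digraph.awalk G_L x ps (v, i) \<longleftrightarrow>
    (\<exists>u p. walk u p v \<and> i \<in> copies v \<and> x = (u, path_idx p i) \<and> ps = lift_path p i)"
proof (induction ps arbitrary: x)
  case Nil
  have "(\<exists>u p. walk u p v \<and> i \<in> copies v \<and> x = (u, path_idx p i) \<and> [] = lift_path p i) \<longleftrightarrow>
      v \<in> Obj C \<and> i \<in> copies v \<and> x = (v, i)"
  proof (intro iffI; elim exE conjE)
    fix u p assume "walk u p v" "i \<in> copies v" "x = (u, path_idx p i)" "[] = lift_path p i"
    then show "v \<in> Obj C \<and> i \<in> copies v \<and> x = (v, i)"
      by (cases p) (auto simp: walk_Nil)
  next
    assume "v \<in> Obj C" "i \<in> copies v" "x = (v, i)"
    then have "walk v [] v \<and> i \<in> copies v \<and> x = (v, path_idx [] i) \<and> [] = lift_path [] i"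
      by (simp add: walk_Nil)
    then show "\<exists>u p. walk u p v \<and> i \<in> copies v \<and> x = (u, path_idx p i) \<and> [] = lift_path p i"
      by blast
  qed
  then show ?case
    unfolding wf_digraph.awalk_Nil_iff[OF wf_limar_digraph] by (auto simp: limar_digraph_sel)
next
  case (Cons a ps)
  obtain e j where a: "a = (e, j)"
    by fastforce
  show ?case (is "?L \<longleftrightarrow> ?R")
  proof
    assume ?L
    then have "e \<in> edges C d" "j \<in> copies (Rng C e)" "x = (Src C e, src_idx e j)"
      "pre_digraph.awalk G_L (Rng C e, j) ps (v, i)"
      by (auto simp: wf_digraph.awalk_Cons_iff[OF wf_limar_digraph] a)
        (auto simp: limar_digraph_sel)
    moreover from this(4) obtain p where "walk (Rng C e) p v" "i \<in> copies v" "j = path_idx p i"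
        "ps = lift_path p i"
      unfolding Cons.IH by auto
    ultimately have "walk (Src C e) (e # p) v \<and> i \<in> copies v \<and> x = (Src C e, path_idx (e # p) i) \<and>
        a # ps = lift_path (e # p) i"
      by (simp add: walk_Cons a)
    then show ?R
      by blast
  next
    assume ?R
    then obtain u q where q: "walk u q v" "i \<in> copies v" "x = (u, path_idx q i)" "a # ps = lift_path q i"
      by blast
    then obtain p where "q = e # p" "j = path_idx p i" "ps = lift_path p i"
      by (cases q) (auto simp: a)
    with q have "e \<in> edges C d" "walk (Rng C e) p v" "i \<in> copies v" "j = path_idx p i"
      "ps = lift_path p i" "x = (Src C e, src_idx e j)"
      by (auto simp: walk_Cons)
    moreover from this have "pre_digraph.awalk G_L (Rng C e, j) ps (v, i)"
      unfolding Cons.IH by auto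
    ultimately show ?L
      using path_idx_in_copies[of "Rng C e" p v i]
      by (simp add: wf_digraph.awalk_Cons_iff[OF wf_limar_digraph] a)
        (simp add: limar_digraph_sel)
  qed
qed

lemma map_fst_lift_path: "map fst (lift_path p i) = p"
  by (induction p) auto

lemma split_pathE:
  assumes "x \<in> paths G_L"
  obtains u p v i where "walk u p v" "i \<in> copies v" "x = ((u, path_idx p i), lift_path p i, (v, i))"
    "par x = (u, p, v)"
proof -
  obtain y ps v i where x: "x = (y, ps, (v, i))" "pre_digraph.awalk G_L y ps (v, i)"
    using assms by (auto simp: paths_def)
  then obtain u p where "walk u p v" "i \<in> copies v" "y = (u, path_idx p i)" "ps = lift_path p i"
    unfolding split_walk_iff by auto
  with x that show ?thesis
    by (auto simp: par_def path_src_def path_edges_def path_rng_def map_fst_lift_path)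
qed

lemma lifted_path:
  assumes "walk u p v" "i \<in> copies v"
  shows "((u, path_idx p i), lift_path p i, (v, i)) \<in> paths G_L"
    and "par ((u, path_idx p i), lift_path p i, (v, i)) = (u, p, v)"
  using assms
  by (auto simp: paths_def split_walk_iff par_def path_src_def path_edges_def path_rng_def
      map_fst_lift_path)

lemma split_over_k_graph:
  "category_over_k_graph (path_category G_L) C d fst (composite C \<circ> par) (limar_path_degree d)"
proof -
  interpret paths: small_category "path_category G_L"
    by (rule path_category_small_category[OF wf_limar_digraph])
  have sel: "Obj (path_category G_L) = verts G_L" "Mor (path_category G_L) = paths G_L"
    "Src (path_category G_L) = path_src" "Rng (path_category G_L) = path_rng"
    "Ident (path_category G_L) u = (u, [], u)"
    "Cmp (path_category G_L) x y = (path_src y, path_edges y @ path_edges x, path_rng x)" for u x y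
    by (simp_all add: path_category_def)
  show ?thesis
  proof (unfold_locales, unfold sel comp_def)
    have "countable (Obj C)"
    proof (rule countable_subset)
      show "Obj C \<subseteq> Src C ` Mor C"
        by (metis Ident_in_Mor Src_Ident image_eqI subsetI)
    qed (simp add: countable_Mor)
    then show "countable (verts G_L)"
      by (simp add: limar_digraph_sel countable_SIGMA)
  next
    fix u :: "'v \<times> nat" assume "u \<in> verts G_L"
    then show "fst u \<in> Obj C"
      by (auto simp: limar_digraph_sel)
  next
    fix x assume "x \<in> paths G_L"
    then show "composite C (par x) \<in> Mor C" "Src C (composite C (par x)) = fst (path_src x)"
      "Rng C (composite C (par x)) = fst (path_rng x)"
      by (auto elim!: split_pathE simp: composite_in_Mor path_src_def path_rng_def)
  next
    fix u :: "'v \<times> nat"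
    show "composite C (par (u, [], u)) = Ident C (fst u)"
      by (simp add: par_def path_src_def path_edges_def path_rng_def composite_Nil)
  next
    fix x y assume x: "x \<in> paths G_L" and y: "y \<in> paths G_L" and "path_src x = path_rng y"
    obtain u p v i where X: "walk u p v" "x = ((u, path_idx p i), lift_path p i, (v, i))"
      using x by (elim split_pathE)
    obtain u' p' v' i' where Y: "walk u' p' v'" "y = ((u', path_idx p' i'), lift_path p' i', (v', i'))"
      using y by (elim split_pathE)
    have "v' = u"
      using X Y \<open>path_src x = path_rng y\<close> by (simp add: path_src_def path_rng_def)
    then show "composite C (par (path_src y, path_edges y @ path_edges x, path_rng x)) =
        Cmp C (composite C (par x)) (composite C (par y))"
      using X Y composite_append
      by (simp add: par_def path_src_def path_edges_def path_rng_def map_fst_lift_path)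
  next
    fix x assume "x \<in> paths G_L"
    then obtain u p v i where X: "walk u p v" "x = ((u, path_idx p i), lift_path p i, (v, i))"
        "par x = (u, p, v)"
      by (elim split_pathE)
    have "limar_path_degree d x = sum_list (map d (map fst (lift_path p i)))"
      using X by (simp add: limar_path_degree_def path_edges_def comp_def case_prod_beta')
    then show "limar_path_degree d x = d (composite C (par x))"
      using X composite_in_Mor(4) by (simp add: map_fst_lift_path)
  next
    fix l and u :: "'v \<times> nat" assume "l \<in> Mor C" "u \<in> verts G_L" "Rng C l = fst u"
    moreover from this obtain p where "walk (Src C l) p (Rng C l)" "composite C (Src C l, p, Rng C l) = l"
      using ex_walk_composite by blast
    ultimately show "\<exists>x\<in>paths G_L. composite C (par x) = l \<and> path_rng x = u"
      using lifted_path[of "Src C l" p "Rng C l" "snd u"]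
      by (intro bexI[of _ "((Src C l, path_idx p (snd u)), lift_path p (snd u), u)"])
        (auto simp: limar_digraph_sel path_rng_def)
  next
    fix x y assume x: "x \<in> paths G_L" and y: "y \<in> paths G_L"
      and eq: "composite C (par x) = composite C (par y)" "path_rng x = path_rng y"
    obtain u p v i where X: "walk u p v" "i \<in> copies v"
        "x = ((u, path_idx p i), lift_path p i, (v, i))" "par x = (u, p, v)"
      using x by (elim split_pathE)
    obtain u' q v' i' where Y: "walk u' q v'"
        "y = ((u', path_idx q i'), lift_path q i', (v', i'))" "par y = (u', q, v')"
      using y by (elim split_pathE)
    have "v' = v" "i' = i"
      using eq(2) X Y by (auto simp: path_rng_def)
    moreover have "u' = u"
      using eq(1) X Y composite_in_Mor(2) by metis
    ultimately have "path_idx p i = path_idx q i"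
      using path_idx_invariant[OF X(1) _ _ X(2)] Y(1,3) X(4) eq(1) by simp
    then show "path_src x = path_src y"
      using X Y \<open>u' = u\<close> \<open>i' = i\<close> by (simp add: path_src_def)
  qed
qed

sublocale split: category_over_k_graph "path_category G_L" C d fst "composite C \<circ> par"
  "limar_path_degree d"
  by (rule split_over_k_graph)

text \<open>The two relations differ in that \<^const>\<open>limar_equiv\<close> also demands equal sources; by the
  invariance of the source index this is automatic.\<close>

lemma limar_equiv_eq: "limar_equiv C d B w E = split.fibre_equiv"
proof -
  have src: "path_src x = path_src y"
    if "x \<in> paths G_L" "y \<in> paths G_L" "composite C (par x) = composite C (par y)"
      "path_rng x = path_rng y" for x y
    using split.lift_Src_unique[of x y] that by (simp add: path_category_def)
  have par: "par x \<in> paths (skeleton C d)" if "x \<in> paths G_L" for x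
    using that by (rule split_pathE) (simp add: paths_def)
  have "(x, y) \<in> limar_equiv C d B w E \<longleftrightarrow> x \<in> paths G_L \<and> y \<in> paths G_L \<and>
      composite C (par x) = composite C (par y) \<and> path_rng x = path_rng y" for x y
    unfolding limar_equiv_def path_equiv_def mem_Collect_eq case_prod_conv
    using src[of x y] par[of x] par[of y] by argo
  moreover have "(x, y) \<in> split.fibre_equiv \<longleftrightarrow> x \<in> paths G_L \<and> y \<in> paths G_L \<and>
      composite C (par x) = composite C (par y) \<and> path_rng x = path_rng y" for x y
    unfolding split.fibre_equiv_def by (simp add: path_category_def)
  ultimately show ?thesis
    by (simp only: set_eq_iff split_paired_All simp_thms)
qed

end

theorem theorem3p9:
  fixes C :: "('v, 'm) category" and d :: "'m \<Rightarrow> nat ^ 'k"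
    and B :: "nat ^ 'k" and w :: 'v and E :: "'v \<Rightarrow> nat \<Rightarrow> 'm set"
  assumes "k_graph C d" and "source_free C d" and "row_finite C d"
    and "B \<in> unit_degrees"
    and "w \<in> Obj C" and "at_least_two (B_edges_from C d B w)"
    and "\<And>v. v \<in> split_verts C d B w \<Longrightarrow> finite (B_edges_from C d B v)"
    and "limar_partition C d B w E"
    and "CARD('k) \<ge> 3 \<Longrightarrow> sink_free C d B"
  shows "k_graph (limar_split C d B w E) (limar_degree d) \<and>
    source_free (limar_split C d B w E) (limar_degree d) \<and>
    row_finite (limar_split C d B w E) (limar_degree d)"
proof -
  interpret limar_data C d B w E
    using assms(1,4,6-) by (intro limar_data.intro limar_data_axioms.intro)
  have "limar_split C d B w E = split.Q" "limar_degree d = split.Q_degree"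
    by (auto simp: limar_split_def limar_equiv_eq limar_degree_def)
  then show ?thesis
    using split.quotient_k_graph split.quotient_source_free split.quotient_row_finite assms(2,3)
    by simp
qed

end
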